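(* Let $\mathcal A$ be a positive algebra with unit $I$ and let $a\in\mathcal A$ be a positive element with spectral radius $r(a)=\lim_{n\to\infty}\|a^n\|^{1/n}$. Then there exists a nonzero positive (continuous) linear functional $\mu:\mathcal A\to\mathbb R$ such that $\mu(xa)=r(a)\mu(x)$ for all $x\in\mathcal A$ and $\|\mu\|=\mu(I)$. Similarly, there exists a nonzero positive (continuous) linear functional $\mu':\mathcal A\to\mathbb R$ such that $\mu'(ax)=r(a)\mu'(x)$ for all $x\in\mathcal A$ and $\|\mu'\|=\mu'(I)$.
   Context: All algebras are real and associative. A cone in a real vector space $L$ is a convex subset $K$ with $tK\subset K$ for $t\ge0$ and such that $v\in K$, $-v\in K$ imply $v=0$; elements of $K$ are called positive. A positive algebra is a real normed algebra $\mathcal A$ (so $\|ab\|\le\|a\|\|b\|$) with a unit $I$, $\|I\|=1$, and with a fixed cone $\mathcal A_+$ such that products of elements of $\mathcal A_+$ lie in $\mathcal A_+$, $I\in\mathcal A_+$, and the norm is monotone: $\|u\|\le\|u+v\|$ for all $u,v\in\mathcal A_+$. (Neither completeness of $\mathcal A$ nor closedness of $\mathcal A_+$ is assumed.) A linear functional is positive if it is nonnegative on $\mathcal A_+$; $\|\mu\|$ is the usual norm of a functional. *)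

theory Defs
  imports "HOL-Analysis.Analysis"
begin

text \<open>
  The library predicate \<open>cone K\<close> only says that \<open>K\<close> is closed under multiplication by
  nonnegative reals; the cones here are moreover convex and pointed.
\<close>

definition pointed_convex_cone :: "'a::real_vector set \<Rightarrow> bool" where
  "pointed_convex_cone K \<longleftrightarrow>
     convex K \<and> cone K \<and> (\<forall>v. v \<in> K \<and> - v \<in> K \<longrightarrow> v = 0)"

text \<open>
  The unital normed algebra is the whole type; the class \<open>real_normed_algebra_1\<close> provides
  associativity, submultiplicativity of the norm and \<open>norm 1 = 1\<close>. Neither completeness
  of the algebra nor closedness of the cone is required.
\<close>

definition positive_algebra :: "'a::real_normed_algebra_1 set \<Rightarrow> bool" where
  "positive_algebra K \<longleftrightarrow>
     pointed_convex_cone K \<and>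
     (\<forall>u\<in>K. \<forall>v\<in>K. u * v \<in> K) \<and>
     1 \<in> K \<and>
     (\<forall>u\<in>K. \<forall>v\<in>K. norm u \<le> norm (u + v))"

text \<open>The limit always exists, by submultiplicativity of the norm (Fekete's lemma).\<close>

definition spectral_radius :: "'a::real_normed_algebra_1 \<Rightarrow> real" where
  "spectral_radius a = lim (\<lambda>n. root n (norm (a ^ n)))"

definition positive_functional :: "'a::real_vector set \<Rightarrow> ('a \<Rightarrow> real) \<Rightarrow> bool" where
  "positive_functional K \<mu> \<longleftrightarrow> linear \<mu> \<and> (\<forall>x\<in>K. 0 \<le> \<mu> x)"

end

theory Submission
  imports Defs
begin

text \<open>
  Let \<open>r\<close> be the spectral radius of \<open>a\<close>. By the Hahn--Banach theorem, a functional as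
  required exists as soon as \<open>1 \<le> norm (1 + k + y a - r y)\<close> for all \<open>k \<in> K\<close> and all \<open>y\<close>.
  Multiplying by a positive \<open>u\<close> and using monotonicity of the norm, this follows if there are
  nonzero positive \<open>u\<close> commuting with \<open>a\<close> for which \<open>norm (a u - r u) / norm u\<close> is arbitrarily
  small. For \<open>r = 0\<close> a power of \<open>a\<close> serves. For \<open>r > 0\<close> take a partial sum \<open>u\<close> of the Neumann
  series of \<open>a / q\<close> with \<open>q\<close> slightly above \<open>r\<close>: then \<open>a u - q u\<close> stays bounded, while
  \<open>norm u\<close> becomes large, because the square of the partial sum of order \<open>M\<close> dominates
  \<open>M + 1\<close> times \<open>(a / q) ^ M\<close>.
\<close>

section \<open>The Hahn--Banach theorem\<close>

definition sublinear :: "('a::real_vector \<Rightarrow> real) \<Rightarrow> bool" where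
  "sublinear p \<longleftrightarrow> (\<forall>x y. p (x + y) \<le> p x + p y) \<and> (\<forall>c\<ge>0. \<forall>x. p (c *\<^sub>R x) = c * p x)"

lemma sublinear_add: "sublinear p \<Longrightarrow> p (x + y) \<le> p x + p y"
  and sublinear_scaleR: "sublinear p \<Longrightarrow> 0 \<le> c \<Longrightarrow> p (c *\<^sub>R x) = c * p x"
  by (auto simp: sublinear_def)

lemma sublinear_0: "sublinear p \<Longrightarrow> p 0 = 0"
  using sublinear_scaleR[of p 0 0] by simp

lemma sublinear_minus_le: "sublinear p \<Longrightarrow> - p (- x) \<le> p x"
  using sublinear_add[of p x "- x"] sublinear_0[of p] by simp

text \<open>Common pattern behind the three infima below: the directional infimum, the pointwise
  infimum of a chain, and the distance to a cone. Here \<open>P x\<close> is the set of values over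
  which the infimum at \<open>x\<close> is taken.\<close>

lemma sublinear_Inf:
  fixes P :: "'a::real_vector \<Rightarrow> real set"
  assumes ne: "\<And>x. P x \<noteq> {}" and bdd: "\<And>x. bdd_below (P x)"
    and add: "\<And>x y s t. s \<in> P x \<Longrightarrow> t \<in> P y \<Longrightarrow> \<exists>u\<in>P (x + y). u \<le> s + t"
    and scale: "\<And>c x s. 0 < c \<Longrightarrow> s \<in> P x \<Longrightarrow> c * s \<in> P (c *\<^sub>R x)"
    and zero: "\<exists>u\<in>P 0. u \<le> 0"
  shows "sublinear (\<lambda>x. Inf (P x))"
proof -
  have le: "Inf (P x) \<le> s" if "s \<in> P x" for x s
    by (rule cInf_lower[OF that bdd])
  have sub: "Inf (P (x + y)) \<le> Inf (P x) + Inf (P y)" for x y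
  proof -
    have *: "Inf (P (x + y)) \<le> s + t" if "s \<in> P x" "t \<in> P y" for s t
      using add[OF that] le by force
    have "Inf (P (x + y)) - s \<le> Inf (P y)" if "s \<in> P x" for s
      by (rule cInf_greatest[OF ne]) (use *[OF that] in \<open>simp add: algebra_simps\<close>)
    then have "Inf (P (x + y)) - Inf (P y) \<le> Inf (P x)"
      by (intro cInf_greatest[OF ne]) (simp add: algebra_simps)
    then show ?thesis by simp
  qed
  have pos: "Inf (P (c *\<^sub>R x)) \<le> c * Inf (P x)" if "0 < c" for c x
  proof -
    have "Inf (P (c *\<^sub>R x)) / c \<le> Inf (P x)"
      by (rule cInf_greatest[OF ne])
        (use le[OF scale[OF that]] that in \<open>simp add: field_simps\<close>)
    with that show ?thesis by (simp add: field_simps)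
  qed
  \<comment> \<open>The reverse inequality is \<open>pos\<close> for the factor \<open>1 / c\<close>
    at the point \<open>c *\<^sub>R x\<close>.\<close>
  have eq: "Inf (P (c *\<^sub>R x)) = c * Inf (P x)" if "0 < c" for c x
    using pos[OF that, of x] pos[of "1 / c" "c *\<^sub>R x"] that by (simp add: field_simps)
  \<comment> \<open>Homogeneity with factor 2 at the origin forces the value 0; this settles the
    factor \<open>c = 0\<close>.\<close>
  have "Inf (P 0) = 0"
    using eq[of 2 0] by simp
  with sub eq show ?thesis
    by (force simp: sublinear_def order.order_iff_strict)
qed

text \<open>The witness is \<open>q x = (INF t\<in>{0..}. p (x + t y) - t p y)\<close>.\<close>

lemma sublinear_directional_Inf:
  fixes p :: "'a::real_vector \<Rightarrow> real"
  assumes "sublinear p"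
  obtains q where "sublinear q" "\<And>x. q x \<le> p x" "\<And>x. q x \<le> p (x + y) - p y"
proof -
  define P where "P x = (\<lambda>t. p (x + t *\<^sub>R y) - t * p y) ` {0..}" for x
  have bdd: "bdd_below (P x)" for x
  proof -
    \<comment> \<open>Subadditivity for
      \<open>t *\<^sub>R y = (x + t *\<^sub>R y) + (- x)\<close>.\<close>
    have "- p (- x) \<le> p (x + t *\<^sub>R y) - t * p y" if "0 \<le> t" for t
      using sublinear_add[OF assms, of "x + t *\<^sub>R y" "- x"] sublinear_scaleR[OF assms that, of y]
      by simp
    then show ?thesis
      by (intro bdd_belowI[of _ "- p (- x)"]) (auto simp: P_def)
  qed
  have le: "Inf (P x) \<le> p (x + t *\<^sub>R y) - t * p y" if "0 \<le> t" for x t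
    by (rule cInf_lower[OF _ bdd]) (use that in \<open>auto simp: P_def\<close>)
  have "sublinear (\<lambda>x. Inf (P x))"
  proof (rule sublinear_Inf)
    show "\<exists>u\<in>P (x + z). u \<le> s + t" if "s \<in> P x" "t \<in> P z" for x z s t
    proof -
      from that obtain a b where ab: "0 \<le> a" "0 \<le> b"
        and st: "s = p (x + a *\<^sub>R y) - a * p y" "t = p (z + b *\<^sub>R y) - b * p y"
        by (auto simp: P_def)
      have "p ((x + z) + (a + b) *\<^sub>R y) - (a + b) * p y \<le> s + t"
        using sublinear_add[OF assms, of "x + a *\<^sub>R y" "z + b *\<^sub>R y"]
        by (simp add: st algebra_simps)
      with ab show ?thesis by (force simp: P_def)
    qed
    show "c * s \<in> P (c *\<^sub>R x)" if c: "0 < c" and "s \<in> P x" for c x s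
    proof -
      from that obtain a where a: "0 \<le> a" and s: "s = p (x + a *\<^sub>R y) - a * p y"
        by (auto simp: P_def)
      have "c * s = p (c *\<^sub>R x + (c * a) *\<^sub>R y) - (c * a) * p y"
        using sublinear_scaleR[OF assms, of c "x + a *\<^sub>R y"] c by (simp add: s algebra_simps)
      with a c show ?thesis by (auto simp: P_def)
    qed
    show "\<exists>u\<in>P 0. u \<le> 0"
      using sublinear_0[OF assms] by (auto simp: P_def intro!: bexI[of _ 0])
  qed (use bdd in \<open>auto simp: P_def\<close>)
  \<comment> \<open>The parameters \<open>t = 0\<close> and \<open>t = 1\<close> give the two upper
    bounds.\<close>
  from this show thesis
    by (rule that) (use le[of 0] le[of 1] in auto)
qed

text \<open>Zorn's lemma for the reversed pointwise order: the pointwise infimum of a nonempty chain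
  is again sublinear, and it is finite because all members of the chain are bounded below by
  \<open>- p (- x)\<close> at \<open>x\<close>.\<close>

lemma ex_minimal_sublinear:
  fixes p :: "'a::real_vector \<Rightarrow> real"
  assumes "sublinear p"
  obtains m where "sublinear m" "m \<le> p" "\<And>q. sublinear q \<Longrightarrow> q \<le> m \<Longrightarrow> q = m"
proof -
  define A where "A = {q. sublinear q \<and> q \<le> p}"
  have "\<exists>m\<in>A. \<forall>q\<in>A. q \<le> m \<longrightarrow> q = m"
  proof (rule predicate_Zorn)
    show "partial_order_on A (relation_of (\<lambda>q q'. q' \<le> q) A)"
      by (rule partial_order_on_relation_ofI) auto
    fix C assume C: "C \<in> Chains (relation_of (\<lambda>q q'. q' \<le> q) A)"
    then have CA: "C \<subseteq> A" and chain: "\<And>q q'. q \<in> C \<Longrightarrow> q' \<in> C \<Longrightarrow> q \<le> q' \<or> q' \<le> q"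
      by (auto simp: Chains_def relation_of_def)
    show "\<exists>m\<in>A. \<forall>q\<in>C. m \<le> q"
    proof (cases "C = {}")
      case True
      with assms show ?thesis by (auto simp: A_def)
    next
      case False
      define P where "P x = (\<lambda>q. q x) ` C" for x
      have sub: "sublinear q" and qp: "q \<le> p" if "q \<in> C" for q
        using CA that by (auto simp: A_def)
      have bdd: "bdd_below (P x)" for x
      proof -
        have "- p (- x) \<le> q x" if "q \<in> C" for q
          using sublinear_minus_le[OF sub[OF that], of x] qp[OF that]
          by (force simp: le_fun_def intro: order_trans[rotated])
        then show ?thesis
          by (intro bdd_belowI[of _ "- p (- x)"]) (auto simp: P_def)
      qed
      have le: "Inf (P x) \<le> q x" if "q \<in> C" for q x
        by (rule cInf_lower[OF _ bdd]) (use that in \<open>auto simp: P_def\<close>)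
      have "sublinear (\<lambda>x. Inf (P x))"
      proof (rule sublinear_Inf)
        show "\<exists>u\<in>P (x + z). u \<le> s + t" if "s \<in> P x" "t \<in> P z" for x z s t
        proof -
          from that obtain q q' where q: "q \<in> C" "q' \<in> C" and st: "s = q x" "t = q' z"
            by (auto simp: P_def)
          \<comment> \<open>Subadditivity survives the infimum because the smaller of two members of
            the chain serves for both summands.\<close>
          with chain obtain m where "m \<in> C" "m \<le> q" "m \<le> q'"
            by blast
          then have "m \<in> C" "m (x + z) \<le> s + t"
            using sublinear_add[OF sub, of m x z]
            by (auto simp: st le_fun_def intro: order_trans[OF _ add_mono])
          then show ?thesis by (auto simp: P_def)
        qed
        show "c * s \<in> P (c *\<^sub>R x)" if "0 < c" "s \<in> P x" for c x s
          using that sublinear_scaleR[OF sub, of _ c x, symmetric] by (force simp: P_def)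
        show "\<exists>u\<in>P 0. u \<le> 0"
          using False sublinear_0[OF sub] by (force simp: P_def)
      qed (use bdd False in \<open>auto simp: P_def\<close>)
      moreover have "(\<lambda>x. Inf (P x)) \<le> p"
      proof -
        from False obtain q where q: "q \<in> C" by blast
        have "Inf (P x) \<le> p x" for x
          using le[OF q, of x] le_funD[OF qp[OF q], of x] by simp
        then show ?thesis by (simp add: le_fun_def)
      qed
      ultimately show ?thesis
        using le by (intro bexI[of _ "\<lambda>x. Inf (P x)"]) (auto simp: A_def le_fun_def)
    qed
  qed
  then obtain m where "m \<in> A" "\<And>q. q \<in> A \<Longrightarrow> q \<le> m \<Longrightarrow> q = m"
    by blast
  then show thesis
    by (intro that[of m]) (auto simp: A_def intro: order_trans)
qed

text \<open>A minimal sublinear functional is linear, as no directional infimum can lie below it.\<close>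

theorem Hahn_Banach_sublinear:
  fixes p :: "'a::real_vector \<Rightarrow> real"
  assumes "sublinear p"
  obtains f where "linear f" "\<And>x. f x \<le> p x" "f e = p e"
proof -
  \<comment> \<open>Replacing \<open>p\<close> by its directional infimum along \<open>e\<close>
    fixes the value at \<open>e\<close> in advance: any \<open>f\<close> below \<open>p'\<close>
    satisfies \<open>f (- e) \<le> p 0 - p e = - p e\<close>.\<close>
  obtain p' where p': "sublinear p'" "\<And>x. p' x \<le> p x" "\<And>x. p' x \<le> p (x + e) - p e"
    by (rule sublinear_directional_Inf[OF assms, of e]) blast
  obtain f where f: "sublinear f" "f \<le> p'" and min: "\<And>q. sublinear q \<Longrightarrow> q \<le> f \<Longrightarrow> q = f"
    by (rule ex_minimal_sublinear[OF p'(1)]) blast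
  have add: "f (x + y) = f x + f y" for x y
  proof -
    obtain q where q: "sublinear q" "\<And>x. q x \<le> f x" "\<And>x. q x \<le> f (x + y) - f y"
      by (rule sublinear_directional_Inf[OF f(1), of y]) blast
    \<comment> \<open>With \<open>q = f\<close> the third bound on \<open>q\<close> becomes
      superadditivity of \<open>f\<close>.\<close>
    then have "q = f" by (intro min) (auto simp: le_fun_def)
    with q(3)[of x] sublinear_add[OF f(1), of x y] show ?thesis by simp
  qed
  have minus: "f (- x) = - f x" for x
    using add[of x "- x"] sublinear_0[OF f(1)] by simp
  have "f (c *\<^sub>R x) = c *\<^sub>R f x" for c x
    using sublinear_scaleR[OF f(1), of c x] sublinear_scaleR[OF f(1), of "- c" x] minus[of "c *\<^sub>R x"]
    by (cases "0 \<le> c") auto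
  then have "linear f"
    by (intro linearI) (simp_all add: add)
  moreover have le: "f x \<le> p x" for x
    using f(2) p'(2)[of x] by (auto simp: le_fun_def intro: order_trans)
  moreover have "f e = p e"
  proof -
    have "f (- e) \<le> p' (- e)" using f(2) by (simp add: le_fun_def)
    also have "\<dots> \<le> - p e" using p'(3)[of "- e"] sublinear_0[OF assms] by simp
    finally show ?thesis using le[of e] minus[of e] by simp
  qed
  ultimately show thesis by (rule that)
qed

text \<open>The distance from \<open>x\<close> to \<open>- S\<close> is sublinear, at most
  \<open>norm x\<close>, and zero on \<open>- S\<close>; the hypothesis on \<open>e\<close> makes it
  equal to \<open>norm e\<close> at \<open>e\<close>. A linear functional dominated by it and
  touching it at \<open>e\<close> has all the required properties.\<close>

corollary norming_functional_nonneg_on_cone: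
  fixes S :: "'a::real_normed_vector set"
  assumes S: "convex_cone S" and e: "\<And>s. s \<in> S \<Longrightarrow> norm e \<le> norm (e + s)"
  obtains f where "linear f" "\<And>x. \<bar>f x\<bar> \<le> norm x" "f e = norm e" "\<And>s. s \<in> S \<Longrightarrow> 0 \<le> f s"
proof -
  define P where "P x = (\<lambda>s. norm (x + s)) ` S" for x
  have S0: "0 \<in> S" by (rule convex_cone_contains_0[OF S])
  have bdd: "bdd_below (P x)" for x
    by (rule bdd_belowI[of _ 0]) (auto simp: P_def)
  have le: "Inf (P x) \<le> norm (x + s)" if "s \<in> S" for x s
    by (rule cInf_lower[OF _ bdd]) (use that in \<open>auto simp: P_def\<close>)
  have "sublinear (\<lambda>x. Inf (P x))"
  proof (rule sublinear_Inf)
    show "\<exists>u\<in>P (x + z). u \<le> s + t" if "s \<in> P x" "t \<in> P z" for x z s t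
    proof -
      from that obtain a b where ab: "a \<in> S" "b \<in> S" and st: "s = norm (x + a)" "t = norm (z + b)"
        by (auto simp: P_def)
      have "norm ((x + z) + (a + b)) \<le> s + t"
        using norm_triangle_ineq[of "x + a" "z + b"] by (simp add: st algebra_simps)
      with convex_cone_add[OF S ab] show ?thesis by (force simp: P_def)
    qed
    show "c * s \<in> P (c *\<^sub>R x)" if c: "0 < c" and "s \<in> P x" for c x s
    proof -
      from that obtain a where a: "a \<in> S" and s: "s = norm (x + a)"
        by (auto simp: P_def)
      have "c * s = norm (c *\<^sub>R x + c *\<^sub>R a)"
        using c by (simp add: s flip: scaleR_add_right)
      with convex_cone_scaleR[OF S _ a, of c] c show ?thesis by (auto simp: P_def)
    qed
    show "\<exists>u\<in>P 0. u \<le> 0"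
      using S0 by (auto simp: P_def)
  qed (use bdd S0 in \<open>auto simp: P_def\<close>)
  then obtain f where f: "linear f" "\<And>x. f x \<le> Inf (P x)" "f e = Inf (P e)"
    by (rule Hahn_Banach_sublinear[where e = e]) blast
  have fn: "f x \<le> norm x" for x
    using f(2)[of x] le[OF S0, of x] by simp
  have "\<bar>f x\<bar> \<le> norm x" for x
    using fn[of x] fn[of "- x"] linear_neg[OF f(1), of x] by simp
  moreover have "f e = norm e"
  proof -
    have "norm e \<le> Inf (P e)"
      by (rule cInf_greatest) (use e S0 in \<open>auto simp: P_def\<close>)
    with fn[of e] f(3) show ?thesis by simp
  qed
  moreover have "0 \<le> f s" if "s \<in> S" for s
    using f(2)[of "- s"] le[OF that, of "- s"] linear_neg[OF f(1), of s] by simp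
  ultimately show thesis using f(1) by (intro that)
qed

section \<open>The spectral radius\<close>

text \<open>Division of the exponent by \<open>m\<close> with remainder; the constant absorbs the
  finitely many remainders.\<close>

lemma norm_power_le_geometric:
  fixes a :: "'a::real_normed_algebra_1"
  assumes m: "0 < m" and q: "0 < q" "norm (a ^ m) \<le> q ^ m"
  obtains C where "0 < C" "\<And>n. norm (a ^ n) \<le> C * q ^ n"
proof -
  \<comment> \<open>The sum bounds every quotient it contains, and its term for \<open>j = 0\<close>
    is 1, so \<open>C\<close> is positive.\<close>
  define C where "C = (\<Sum>j<m. norm (a ^ j) / q ^ j)"
  have C_ge: "norm (a ^ j) / q ^ j \<le> C" if "j < m" for j
    unfolding C_def by (rule member_le_sum) (use that q in auto)
  have "1 \<le> C" using C_ge[OF m] by simp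
  moreover have "norm (a ^ n) \<le> C * q ^ n" for n
  proof -
    have "a ^ n = (a ^ m) ^ (n div m) * a ^ (n mod m)"
      by (simp flip: power_mult power_add)
    then have "norm (a ^ n) \<le> norm ((a ^ m) ^ (n div m)) * norm (a ^ (n mod m))"
      by (simp add: norm_mult_ineq)
    also have "\<dots> \<le> norm (a ^ m) ^ (n div m) * norm (a ^ (n mod m))"
      by (intro mult_right_mono norm_power_ineq norm_ge_zero)
    also have "\<dots> \<le> (q ^ m) ^ (n div m) * (C * q ^ (n mod m))"
      using C_ge[of "n mod m"] m q by (intro mult_mono power_mono) (auto simp: field_simps)
    also have "\<dots> = C * q ^ n"
      by (simp add: mult.left_commute flip: power_mult power_add)
    finally show ?thesis .
  qed
  ultimately show thesis by (intro that[of C]) auto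
qed

context
  fixes a :: "'a::real_normed_algebra_1"
begin

text \<open>By Fekete's lemma this infimum is the limit. The index 0 is excluded because
  \<open>root 0\<close> is constantly 0.\<close>

private definition rad :: real where
  "rad = (INF n\<in>{0<..}. root n (norm (a ^ n)))"

private lemma bdd: "bdd_below ((\<lambda>n. root n (norm (a ^ n))) ` {0<..})"
  by (rule bdd_belowI[of _ 0]) (auto simp: real_root_ge_zero)

private lemma rad_le: "0 < n \<Longrightarrow> rad \<le> root n (norm (a ^ n))"
  unfolding rad_def by (rule cINF_lower[OF bdd]) simp

private lemma rad_nonneg: "0 \<le> rad"
  unfolding rad_def by (rule cINF_greatest) (auto simp: real_root_ge_zero)

private lemma geometric:
  assumes "rad < q"
  obtains C where "0 < C" "\<And>n. norm (a ^ n) \<le> C * q ^ n"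
proof -
  have q: "0 < q" using assms rad_nonneg by linarith
  obtain m where m: "0 < m" "root m (norm (a ^ m)) < q"
    using assms bdd unfolding rad_def by (subst (asm) cINF_less_iff) auto
  then have "norm (a ^ m) \<le> q ^ m"
    by (metis less_imp_le norm_ge_zero real_root_pow_pos2 power_mono real_root_ge_zero)
  with norm_power_le_geometric[OF m(1) q] that show thesis by blast
qed

text \<open>From below, no term of positive index is less than the infimum. From above, the
  geometric bound gives at most \<open>root n C * q\<close>, and \<open>root n C\<close> tends to
  1.\<close>

private lemma lim_rad: "(\<lambda>n. root n (norm (a ^ n))) \<longlonglongrightarrow> rad"
proof (rule order_tendstoI)
  fix l assume l: "l < rad"
  show "\<forall>\<^sub>F n in sequentially. l < root n (norm (a ^ n))"
    using eventually_gt_at_top[of 0]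
  proof eventually_elim
    case (elim n)
    with l rad_le[of n] show ?case by simp
  qed
next
  fix u assume "rad < u"
  then obtain q where q: "rad < q" "q < u" using dense by blast
  with rad_nonneg have q0: "0 < q" by linarith
  obtain C where C: "0 < C" "\<And>n. norm (a ^ n) \<le> C * q ^ n"
    using geometric[OF q(1)] by blast
  have "(\<lambda>n. root n C * q) \<longlonglongrightarrow> 1 * q"
    by (intro tendsto_intros LIMSEQ_root_const C)
  then have "\<forall>\<^sub>F n in sequentially. root n C * q < u"
    using q(2) by (intro order_tendstoD(2)) auto
  then show "\<forall>\<^sub>F n in sequentially. root n (norm (a ^ n)) < u"
    using eventually_gt_at_top[of 0]
  proof eventually_elim
    case (elim n)
    have "root n (norm (a ^ n)) \<le> root n (C * q ^ n)"
      using elim C by simp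
    also have "\<dots> = root n C * q"
      using elim q0 by (simp add: real_root_mult real_root_power_cancel)
    finally show ?case using elim by simp
  qed
qed

private lemma spectral_radius_eq: "spectral_radius a = rad"
  unfolding spectral_radius_def by (rule limI[OF lim_rad])

lemma spectral_radius_nonneg: "0 \<le> spectral_radius a"
  by (simp add: spectral_radius_eq rad_nonneg)

lemma spectral_radius_power_le: "spectral_radius a ^ n \<le> norm (a ^ n)"
proof (cases "n = 0")
  case False
  then show ?thesis
    using power_mono[OF rad_le rad_nonneg, of n n]
    by (simp add: spectral_radius_eq real_root_pow_pos2)
qed simp

text \<open>Comparison with a geometric sequence of ratio \<open>q' / q\<close>, where
  \<open>q'\<close> lies strictly between the spectral radius and \<open>q\<close>.\<close>

lemma norm_power_div_tendsto_0:
  assumes "spectral_radius a < q"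
  shows "(\<lambda>n. norm (a ^ n) / q ^ n) \<longlonglongrightarrow> 0"
proof -
  obtain q' where q': "rad < q'" "q' < q"
    using assms dense by (auto simp: spectral_radius_eq)
  with rad_nonneg have q0: "0 < q'" by linarith
  obtain C where C: "0 < C" "\<And>n. norm (a ^ n) \<le> C * q' ^ n"
    using geometric[OF q'(1)] by blast
  have "(\<lambda>n. C * (q' / q) ^ n) \<longlonglongrightarrow> C * 0"
    using q' q0 by (intro tendsto_intros) (auto simp: field_simps)
  then have lim: "(\<lambda>n. C * (q' / q) ^ n) \<longlonglongrightarrow> 0" by simp
  have "norm (norm (a ^ n) / q ^ n) \<le> C * (q' / q) ^ n" for n
    using C(2)[of n] q' q0 by (simp add: power_divide divide_right_mono)
  then show ?thesis
    by (intro Lim_null_comparison[OF _ lim] always_eventually allI)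
qed

end

section \<open>Approximate positive eigenvectors\<close>

text \<open>Telescoping, in the form that shows the partial sum to be fixed by \<open>b\<close> up
  to boundary terms.\<close>

lemma mult_geometric_sum:
  fixes b :: "'a::ring_1"
  shows "b * (\<Sum>n\<le>N. b ^ n) = (\<Sum>n\<le>N. b ^ n) + b ^ Suc N - 1"
  by (induction N) (auto simp: algebra_simps)

context
  fixes K :: "'a::real_normed_algebra_1 set"
  assumes K: "positive_algebra K"
begin

lemma positive_algebra_convex_cone: "convex_cone K"
  using K by (auto simp: positive_algebra_def pointed_convex_cone_def cone_def convex_cone_def conic_def)

lemma positive_algebra_mult: "u \<in> K \<Longrightarrow> v \<in> K \<Longrightarrow> u * v \<in> K"
  and positive_algebra_one: "1 \<in> K"
  and norm_le_norm_add: "u \<in> K \<Longrightarrow> v \<in> K \<Longrightarrow> norm u \<le> norm (u + v)"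
  using K by (auto simp: positive_algebra_def)

lemma positive_algebra_power: "u \<in> K \<Longrightarrow> u ^ n \<in> K"
  by (induction n) (auto intro: positive_algebra_one positive_algebra_mult)

lemma positive_algebra_sum: "(\<And>i. i \<in> A \<Longrightarrow> f i \<in> K) \<Longrightarrow> sum f A \<in> K"
  by (induction A rule: infinite_finite_induct)
    (auto intro: convex_cone_contains_0 convex_cone_add positive_algebra_convex_cone)

lemma norm_sum_mono:
  assumes "finite B" "A \<subseteq> B" "\<And>i. i \<in> B \<Longrightarrow> f i \<in> K"
  shows "norm (sum f A) \<le> norm (sum f B)"
proof -
  have "sum f B = sum f A + sum f (B - A)"
    using assms by (simp add: sum.subset_diff add.commute)
  with assms show ?thesis
    by (auto intro!: norm_le_norm_add positive_algebra_sum)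
qed

text \<open>The square of the sum contains the term \<open>b ^ M\<close> with multiplicity \<open>M + 1\<close>.\<close>

lemma norm_power_le_norm_geometric_sum:
  assumes b: "b \<in> K"
  shows "(real M + 1) * norm (b ^ M) \<le> (norm (\<Sum>n\<le>M. b ^ n))\<^sup>2"
proof -
  \<comment> \<open>The antidiagonal of the square of indices: \<open>M + 1\<close> pairs, each
    contributing \<open>b ^ M\<close>.\<close>
  define D where "D = (\<lambda>i. (i, M - i)) ` {..M}"
  have inj: "inj_on (\<lambda>i. (i, M - i)) {..M}" by (auto intro: inj_onI)
  have "(real M + 1) * norm (b ^ M) = norm (\<Sum>(i,j)\<in>D. b ^ i * b ^ j)"
  proof -
    have "(\<Sum>(i,j)\<in>D. b ^ i * b ^ j) = (\<Sum>i\<le>M. b ^ M)"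
      unfolding D_def by (subst sum.reindex[OF inj]) (auto simp flip: power_add)
    also have "\<dots> = (real M + 1) *\<^sub>R b ^ M"
      unfolding sum_constant_scaleR by (simp add: add.commute)
    finally show ?thesis by simp
  qed
  also have "\<dots> \<le> norm (\<Sum>(i,j)\<in>{..M}\<times>{..M}. b ^ i * b ^ j)"
    by (rule norm_sum_mono)
      (auto simp: D_def intro: positive_algebra_mult positive_algebra_power b)
  also have "(\<Sum>(i,j)\<in>{..M}\<times>{..M}. b ^ i * b ^ j) = (\<Sum>n\<le>M. b ^ n) * (\<Sum>n\<le>M. b ^ n)"
    by (simp add: sum_product sum.cartesian_product)
  also have "norm \<dots> \<le> (norm (\<Sum>n\<le>M. b ^ n))\<^sup>2"
    by (simp add: power2_eq_square norm_mult_ineq)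
  finally show ?thesis .
qed

text \<open>The vector \<open>u\<close> is a polynomial in \<open>a\<close>, hence commutes with it;
  thus one choice serves both left and right multiplication.\<close>

lemma approximate_eigenvector:
  assumes a: "a \<in> K" and \<epsilon>: "0 < \<epsilon>"
  obtains u where "u \<in> K" "u \<noteq> 0" "a * u = u * a"
    "norm (a * u - spectral_radius a *\<^sub>R u) \<le> \<epsilon> * norm u"
proof (cases "spectral_radius a = 0")
  case True
  \<comment> \<open>If no power worked, induction would keep all powers nonzero with norm at least
    \<open>\<epsilon> ^ n\<close>, against spectral radius 0.\<close>
  have "\<exists>n. a ^ n \<noteq> 0 \<and> norm (a ^ Suc n) \<le> \<epsilon> * norm (a ^ n)"
  proof (rule ccontr)
    assume "\<nexists>n. a ^ n \<noteq> 0 \<and> norm (a ^ Suc n) \<le> \<epsilon> * norm (a ^ n)"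
    then have grow: "\<epsilon> * norm (a ^ n) < norm (a ^ Suc n)" if "a ^ n \<noteq> 0" for n
      using that by (meson not_le)
    have "a ^ n \<noteq> 0 \<and> \<epsilon> ^ n \<le> norm (a ^ n)" for n
    proof (induction n)
      case (Suc n)
      then have "\<epsilon> ^ Suc n \<le> \<epsilon> * norm (a ^ n)" using \<epsilon> by simp
      also have "\<dots> < norm (a ^ Suc n)" using grow Suc by blast
      finally have "\<epsilon> ^ Suc n < norm (a ^ Suc n)" .
      moreover from this \<epsilon> have "0 < norm (a ^ Suc n)"
        by (meson less_trans zero_less_power)
      ultimately show ?case by (metis less_imp_le norm_zero less_irrefl)
    qed simp
    then have "1 \<le> norm (a ^ n) / \<epsilon> ^ n" for n
      using \<epsilon> by (simp add: field_simps)
    moreover have "(\<lambda>n. norm (a ^ n) / \<epsilon> ^ n) \<longlonglongrightarrow> 0"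
      using True \<epsilon> by (intro norm_power_div_tendsto_0) auto
    ultimately show False
      using LIMSEQ_le_const[of _ 0 "1::real"] by force
  qed
  then obtain n where "a ^ n \<noteq> 0" "norm (a ^ Suc n) \<le> \<epsilon> * norm (a ^ n)" by blast
  with True a show thesis
    by (intro that[of "a ^ n"]) (auto simp: power_commutes intro: positive_algebra_power)
next
  case False
  define r where "r = spectral_radius a"
  have r: "0 < r" using False spectral_radius_nonneg[of a] by (simp add: r_def)
  \<comment> \<open>Once \<open>norm u\<close> reaches \<open>B\<close>, the boundary error, at most
    \<open>2 * (r + 1)\<close>, is at most half of \<open>\<epsilon> * norm u\<close>.\<close>
  define B where "B = 4 * (r + 1) / \<epsilon>"
  have B: "0 < B" using r \<epsilon> by (simp add: B_def)
  obtain M :: nat where M: "2 * B\<^sup>2 < real M" using reals_Archimedean2 by blast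
  \<comment> \<open>The order of choices matters: \<open>M\<close> is fixed first, and only then is
    \<open>q\<close> moved so close to \<open>r\<close> that \<open>(r / q) ^ M\<close> exceeds
    1/2.\<close>
  have "((\<lambda>q. (r / q) ^ M) \<longlongrightarrow> (r / r) ^ M) (at_right r)"
    using r by (intro tendsto_intros) auto
  then have "\<forall>\<^sub>F q in at_right r. 1 / 2 < (r / q) ^ M"
    using r by (intro order_tendstoD(1)) auto
  moreover have "\<forall>\<^sub>F q in at_right r. q < r + min 1 (\<epsilon> / 2)"
    using \<epsilon> by (intro eventually_at_rightI[of r "r + min 1 (\<epsilon> / 2)"]) auto
  moreover have "\<forall>\<^sub>F q in at_right r. r < q"
    by (simp add: eventually_at_filter)
  ultimately have "\<forall>\<^sub>F q in at_right r. 1 / 2 < (r / q) ^ M \<and> q < r + min 1 (\<epsilon> / 2) \<and> r < q"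
    by eventually_elim auto
  then obtain q where q: "1 / 2 < (r / q) ^ M" "q < r + 1" "q < r + \<epsilon> / 2" "r < q"
    using eventually_happens[of _ "at_right r"] trivial_limit_at_right_real by fastforce
  define b where "b = (1 / q) *\<^sub>R a"
  have q0: "0 < q" using q r by simp
  have a_eq: "a = q *\<^sub>R b" using q0 by (simp add: b_def)
  have b: "b \<in> K"
    unfolding b_def using q0 by (intro convex_cone_scaleR positive_algebra_convex_cone a) auto
  have norm_b: "norm (b ^ n) = norm (a ^ n) / q ^ n" for n
    using q0 by (simp add: b_def power_divide scaleR_power field_simps)
  have "(\<lambda>n. norm (b ^ n)) \<longlonglongrightarrow> 0"
    unfolding norm_b using q by (intro norm_power_div_tendsto_0) (simp add: r_def)
  then have "\<forall>\<^sub>F n in sequentially. norm (b ^ n) < 1"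
    by (rule order_tendstoD) simp
  then obtain N\<^sub>0 where "\<And>n. N\<^sub>0 \<le> n \<Longrightarrow> norm (b ^ n) < 1"
    by (auto simp: eventually_sequentially)
  \<comment> \<open>Beyond \<open>M\<close>, so that \<open>u\<close> dominates the sum of order
    \<open>M\<close>, and late enough for the boundary term \<open>b ^ Suc N - 1\<close> to have
    norm at most 2.\<close>
  then obtain N where N: "M \<le> N" "norm (b ^ Suc N) < 1"
    using that[of "max M N\<^sub>0"] le_SucI[OF max.cobounded2[of N\<^sub>0 M]] by (metis max.cobounded1)
  define u where "u = (\<Sum>n\<le>N. b ^ n)"
  have "u \<in> K" unfolding u_def by (intro positive_algebra_sum positive_algebra_power b)
  have "B \<le> norm u"
  proof (rule power2_le_imp_le)
    have "B\<^sup>2 \<le> (real M + 1) * (1 / 2)" using M by simp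
    also have "\<dots> \<le> (real M + 1) * norm (b ^ M)"
    proof (rule mult_left_mono)
      have "(r / q) ^ M \<le> norm (b ^ M)"
        using spectral_radius_power_le[of a M] q0
        by (simp add: norm_b power_divide r_def divide_right_mono)
      with q(1) show "1 / 2 \<le> norm (b ^ M)" by simp
    qed simp
    also have "\<dots> \<le> (norm (\<Sum>n\<le>M. b ^ n))\<^sup>2"
      by (rule norm_power_le_norm_geometric_sum[OF b])
    also have "\<dots> \<le> (norm u)\<^sup>2"
      unfolding u_def using N by (intro power_mono norm_sum_mono positive_algebra_power b) auto
    finally show "B\<^sup>2 \<le> (norm u)\<^sup>2" .
  qed simp
  then have "4 * (r + 1) \<le> \<epsilon> * norm u"
    using \<epsilon> by (simp add: B_def field_simps)
  have "norm (a * u - r *\<^sub>R u) \<le> \<epsilon> * norm u"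
  proof -
    \<comment> \<open>The first summand is small relative to \<open>u\<close> since
      \<open>q - r < \<epsilon> / 2\<close>; the second is bounded independently of
      \<open>u\<close>.\<close>
    have "a * u - r *\<^sub>R u = (q - r) *\<^sub>R u + q *\<^sub>R (b ^ Suc N - 1)"
      unfolding u_def a_eq mult_scaleR_left mult_geometric_sum by (simp add: algebra_simps)
    also have "norm \<dots> \<le> norm ((q - r) *\<^sub>R u) + norm (q *\<^sub>R (b ^ Suc N - 1))"
      by (rule norm_triangle_ineq)
    also have "norm ((q - r) *\<^sub>R u) \<le> \<epsilon> / 2 * norm u"
      using q unfolding norm_scaleR by (intro mult_right_mono) auto
    also have "norm (q *\<^sub>R (b ^ Suc N - 1)) \<le> (r + 1) * 2"
    proof -
      have "norm (b ^ Suc N - 1) \<le> 2"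
        using norm_triangle_ineq4[of "b ^ Suc N" 1] N(2) by simp
      then show ?thesis using q q0 unfolding norm_scaleR by (intro mult_mono) auto
    qed
    finally show ?thesis using \<open>4 * (r + 1) \<le> \<epsilon> * norm u\<close> by simp
  qed
  moreover have "u \<noteq> 0" using \<open>B \<le> norm u\<close> B by auto
  moreover have "a * u = u * a"
    unfolding u_def a_eq by (simp add: sum_distrib_left sum_distrib_right power_commutes scaleR_sum_right)
  ultimately show thesis
    using \<open>u \<in> K\<close> that[of u] by (simp add: r_def)
qed

section \<open>Eigenfunctionals from approximate eigenvectors\<close>

text \<open>
  Right and left multiplication by \<open>a\<close> are treated at once: \<open>D\<close> is \<open>y \<mapsto> y a - r y\<close> or
  \<open>y \<mapsto> a y - r y\<close>, and \<open>R u\<close> is multiplication by \<open>u\<close> on the same side.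
\<close>

lemma positive_functional_vanishing_on_range:
  fixes D :: "'a \<Rightarrow> 'a" and R :: "'a \<Rightarrow> 'a \<Rightarrow> 'a"
  assumes D: "linear D"
    and R_add: "\<And>u x y. R u (x + y) = R u x + R u y"
    and R_one: "\<And>u. R u 1 = u"
    and R_pos: "\<And>u x. u \<in> K \<Longrightarrow> x \<in> K \<Longrightarrow> R u x \<in> K"
    and R_norm: "\<And>u x. norm (R u x) \<le> norm x * norm u"
    and small: "\<And>\<epsilon>. 0 < \<epsilon> \<Longrightarrow> \<exists>u\<in>K. u \<noteq> 0 \<and> (\<forall>y. norm (R u (D y)) \<le> norm y * (\<epsilon> * norm u))"
  shows "\<exists>\<mu>. bounded_linear \<mu> \<and> positive_functional K \<mu> \<and> \<mu> \<noteq> (\<lambda>x. 0) \<and>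
           (\<forall>y. \<mu> (D y) = 0) \<and> onorm \<mu> = \<mu> 1"
proof -
  \<comment> \<open>Nonnegativity on \<open>S\<close> encodes both goals: positivity on
    \<open>K\<close>, and vanishing on the range of \<open>D\<close>, which is a subspace.\<close>
  define S where "S = {k + D y | k y. k \<in> K}"
  have S: "convex_cone S"
    unfolding convex_cone_iff
  proof (intro conjI ballI allI impI)
    show "0 \<in> S"
      using convex_cone_contains_0[OF positive_algebra_convex_cone] linear_0[OF D]
      by (force simp: S_def)
    fix x assume "x \<in> S"
    then obtain k y where k: "k \<in> K" and x: "x = k + D y" by (auto simp: S_def)
    show "x + x' \<in> S" if "x' \<in> S" for x'
    proof -
      from that obtain k' y' where k': "k' \<in> K" and x': "x' = k' + D y'" by (auto simp: S_def)
      have "x + x' = (k + k') + D (y + y')" by (simp add: x x' linear_add[OF D])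
      with convex_cone_add[OF positive_algebra_convex_cone k k'] show ?thesis
        unfolding S_def by blast
    qed
    show "c *\<^sub>R x \<in> S" if "0 \<le> c" for c
    proof -
      have "c *\<^sub>R x = c *\<^sub>R k + D (c *\<^sub>R y)" by (simp add: x linear_scale[OF D] scaleR_add_right)
      with convex_cone_scaleR[OF positive_algebra_convex_cone that k] show ?thesis
        unfolding S_def by blast
    qed
  qed
  have one: "norm (1::'a) \<le> norm (1 + s)" if "s \<in> S" for s
  proof -
    from that obtain k y where k: "k \<in> K" and s: "s = k + D y" by (auto simp: S_def)
    have "1 \<le> norm (1 + s) + e" if e: "0 < e" for e
    proof -
      \<comment> \<open>Scaled so that \<open>norm y * \<epsilon> \<le> e\<close>; the added 1
        covers \<open>y = 0\<close>.\<close>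
      define \<epsilon> where "\<epsilon> = e / (norm y + 1)"
      have "0 < \<epsilon>" using e by (simp add: \<epsilon>_def add_nonneg_pos)
      then obtain u where u: "u \<in> K" "u \<noteq> 0" "norm (R u (D y)) \<le> norm y * (\<epsilon> * norm u)"
        using small by blast
      have "norm u \<le> norm (u + R u k)"
        by (intro norm_le_norm_add R_pos u k)
      \<comment> \<open>Applying \<open>R u\<close> to \<open>1 + s = 1 + k + D y\<close> leaves the
        positive part \<open>u + R u k\<close> and the small error \<open>R u (D y)\<close>.\<close>
      also have "u + R u k = R u (1 + s) - R u (D y)"
        by (simp add: s R_add R_one)
      also have "norm \<dots> \<le> norm (1 + s) * norm u + norm y * (\<epsilon> * norm u)"
        using norm_triangle_ineq4 R_norm u(3) by (rule order_trans[OF _ add_mono])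
      also have "\<dots> = (norm (1 + s) + norm y * \<epsilon>) * norm u"
        by (simp add: algebra_simps)
      finally have "1 \<le> norm (1 + s) + norm y * \<epsilon>"
        using u(2) by simp
      moreover have "norm y * \<epsilon> \<le> e"
      proof -
        have "norm y * \<epsilon> \<le> (norm y + 1) * \<epsilon>"
          using \<open>0 < \<epsilon>\<close> by (intro mult_right_mono) auto
        also have "\<dots> = e"
          by (simp add: \<epsilon>_def add_nonneg_eq_0_iff)
        finally show ?thesis .
      qed
      ultimately show ?thesis by simp
    qed
    then show ?thesis by (auto intro: field_le_epsilon)
  qed
  obtain \<mu> :: "'a \<Rightarrow> real"
    where \<mu>: "linear \<mu>" "\<And>x. \<bar>\<mu> x\<bar> \<le> norm x" "\<mu> 1 = norm (1::'a)"
      and nonneg: "\<And>s. s \<in> S \<Longrightarrow> 0 \<le> \<mu> s"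
    by (rule norming_functional_nonneg_on_cone[OF S one]) blast+
  have one: "\<mu> 1 = 1" using \<mu>(3) by simp
  have bl: "bounded_linear \<mu>"
    by (rule bounded_linear_intro[of _ 1]) (use \<mu> in \<open>auto simp: linear_add linear_scale\<close>)
  have "k + D 0 \<in> S" if "k \<in> K" for k
    using that unfolding S_def by blast
  then have "positive_functional K \<mu>"
    using \<mu>(1) nonneg linear_0[OF D] by (force simp: positive_functional_def)
  moreover have "\<mu> (D y) = 0" for y
  proof -
    have "0 + D z \<in> S" for z
      unfolding S_def using convex_cone_contains_0[OF positive_algebra_convex_cone] by blast
    then have "D z \<in> S" for z by simp
    \<comment> \<open>Both \<open>D y\<close> and its negative lie in \<open>S\<close>.\<close>
    from nonneg[OF this, of y] nonneg[OF this, of "- y"] show ?thesis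
      by (simp add: linear_neg[OF D] linear_neg[OF \<mu>(1)])
  qed
  moreover have "onorm \<mu> = 1"
  proof (rule antisym)
    show "onorm \<mu> \<le> 1" by (rule onorm_bound) (simp_all add: \<mu>(2))
    show "1 \<le> onorm \<mu>" using onorm[OF bl, of 1] one by simp
  qed
  ultimately show ?thesis using bl one by (intro exI[of _ \<mu>]) auto
qed

end

theorem theorem4p3:
  fixes K :: "'a::real_normed_algebra_1 set" and a :: 'a
  assumes "positive_algebra K" and "a \<in> K"
  shows "(\<exists>\<mu> :: 'a \<Rightarrow> real. bounded_linear \<mu> \<and> positive_functional K \<mu> \<and> \<mu> \<noteq> (\<lambda>x. 0) \<and>
            (\<forall>x. \<mu> (x * a) = spectral_radius a * \<mu> x) \<and> onorm \<mu> = \<mu> 1) \<and>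
         (\<exists>\<mu>' :: 'a \<Rightarrow> real. bounded_linear \<mu>' \<and> positive_functional K \<mu>' \<and> \<mu>' \<noteq> (\<lambda>x. 0) \<and>
            (\<forall>x. \<mu>' (a * x) = spectral_radius a * \<mu>' x) \<and> onorm \<mu>' = \<mu>' 1)"
proof -
  define r where "r = spectral_radius a"
  have eigen: "\<mu> z = r * \<mu> x" if "bounded_linear \<mu>" "\<mu> (z - r *\<^sub>R x) = 0" for \<mu> :: "'a \<Rightarrow> real" and x z
    using that bounded_linear.linear[OF that(1)] by (simp add: linear_diff linear_scale)
  have approx: "\<exists>u\<in>K. u \<noteq> 0 \<and> a * u = u * a \<and> norm (a * u - r *\<^sub>R u) \<le> \<epsilon> * norm u"
    if "0 < \<epsilon>" for \<epsilon>
    using approximate_eigenvector[OF assms that] unfolding r_def by metis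
  have "\<exists>\<mu>. bounded_linear \<mu> \<and> positive_functional K \<mu> \<and> \<mu> \<noteq> (\<lambda>x. 0) \<and>
           (\<forall>y. \<mu> (y * a - r *\<^sub>R y) = 0) \<and> onorm \<mu> = \<mu> 1"
  proof (rule positive_functional_vanishing_on_range[OF assms(1), where R = "\<lambda>u x. x * u"])
    fix \<epsilon> :: real assume "0 < \<epsilon>"
    then obtain u where u: "u \<in> K" "u \<noteq> 0" "norm (a * u - r *\<^sub>R u) \<le> \<epsilon> * norm u"
      using approx by blast
    have "norm ((y * a - r *\<^sub>R y) * u) \<le> norm y * (\<epsilon> * norm u)" for y
    proof -
      have "(y * a - r *\<^sub>R y) * u = y * (a * u - r *\<^sub>R u)" by (simp add: algebra_simps)
      then show ?thesis
        using norm_mult_ineq[of y "a * u - r *\<^sub>R u"] mult_left_mono[OF u(3), of "norm y"] by simp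
    qed
    with u show "\<exists>u\<in>K. u \<noteq> 0 \<and> (\<forall>y. norm ((y * a - r *\<^sub>R y) * u) \<le> norm y * (\<epsilon> * norm u))"
      by blast
  next
    show "norm (x * u) \<le> norm x * norm u" for u x :: 'a
      by (rule norm_mult_ineq)
  qed (auto simp: algebra_simps intro!: linearI positive_algebra_mult[OF assms(1)])
  moreover have "\<exists>\<mu>. bounded_linear \<mu> \<and> positive_functional K \<mu> \<and> \<mu> \<noteq> (\<lambda>x. 0) \<and>
           (\<forall>y. \<mu> (a * y - r *\<^sub>R y) = 0) \<and> onorm \<mu> = \<mu> 1"
  proof (rule positive_functional_vanishing_on_range[OF assms(1), where R = "\<lambda>u x. u * x"])
    fix \<epsilon> :: real assume "0 < \<epsilon>"
    then obtain u where u: "u \<in> K" "u \<noteq> 0" "a * u = u * a" "norm (a * u - r *\<^sub>R u) \<le> \<epsilon> * norm u"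
      using approx by blast
    have "norm (u * (a * y - r *\<^sub>R y)) \<le> norm y * (\<epsilon> * norm u)" for y
    proof -
      \<comment> \<open>Commutation turns \<open>u * a\<close> into \<open>a * u\<close>, so that
        \<open>y\<close> can be split off on the right.\<close>
      have "u * (a * y - r *\<^sub>R y) = (a * u - r *\<^sub>R u) * y" by (simp add: u(3) algebra_simps)
      then show ?thesis
        using norm_mult_ineq[of "a * u - r *\<^sub>R u" y] mult_left_mono[OF u(4), of "norm y"]
        by (simp add: mult.commute)
    qed
    with u show "\<exists>u\<in>K. u \<noteq> 0 \<and> (\<forall>y. norm (u * (a * y - r *\<^sub>R y)) \<le> norm y * (\<epsilon> * norm u))"
      by blast
  next
    show "norm (u * x) \<le> norm x * norm u" for u x :: 'a
      by (metis mult.commute norm_mult_ineq)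
  qed (auto simp: algebra_simps intro!: linearI positive_algebra_mult[OF assms(1)])
  ultimately show ?thesis
    using eigen unfolding r_def by meson
qed

end
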